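(* Assume $0\in I\subseteq\mathbb{R}_-$ or $I=\mathbb{R}$. A function $f\colon I^n\to\mathbb{R}$ is horizontally max-additive if and only if there exists $h\colon I^n\to\mathbb{R}$, with $\delta_h$ additive and $\delta_h^A|_{I_-}$ additive for every $A\subseteq[n]$, such that, for every $\sigma\in S_n$, $$f(\mathbf{x})=\delta_h(x_{\sigma(n)})+\sum_{i=1}^{n-1}\delta_h^{A_\sigma^{\downarrow}(i)}\big(x_{\sigma(i)}-x_{\sigma(i+1)}\big)\qquad(\mathbf{x}\in I^n_\sigma).$$ In this case, we can choose $h=f$.
   Context: $n\geq 1$ is an integer, $[n]=\{1,\ldots,n\}$, $S_n$ is the set of permutations of $[n]$, and $I$ is a nontrivial (i.e., of positive measure) real interval, possibly unbounded, containing $0$. $\mathbb{R}_-=\,]-\infty,0]$ and $I_-=I\cap\mathbb{R}_-$. For $\sigma\in S_n$, $I^n_\sigma=\{\mathbf{x}\in I^n : x_{\sigma(1)}\leq\cdots\leq x_{\sigma(n)}\}$ and $A_\sigma^{\downarrow}(i)=\{\sigma(1),\ldots,\sigma(i)\}$. For $A\subseteq[n]$, $\mathbf{1}_A$ is the $n$-tuple whose $i$th component is $1$ if $i\in A$ and $0$ otherwise. For $h\colon I^n\to\mathbb{R}$, $\delta_h^A\colon I\to\mathbb{R}$ is defined by $\delta_h^A(x)=h(x\mathbf{1}_A)$, and $\delta_h=\delta_h^{[n]}$. A function $u\colon K\to\mathbb{R}$ on an interval $K$ is additive if $u(x+x')=u(x)+u(x')$ whenever $x,x',x+x'\in K$.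 For $\mathbf{x}\in I^n$ and $c\in I$, $\mathbf{x}\vee c$ is the $n$-tuple whose $i$th component is $\max(x_i,c)$, and $[\mathbf{x}]^c=\mathbf{x}-(\mathbf{x}\vee c)$. A function $f\colon I^n\to\mathbb{R}$ is horizontally max-additive if $f(\mathbf{x})=f(\mathbf{x}\vee c)+f([\mathbf{x}]^c)$ for every $\mathbf{x}\in I^n$ and every $c\in I$ such that $[\mathbf{x}]^c\in I^n$. *)

theory Defs
  imports "HOL-Analysis.Analysis" "HOL-Combinatorics.Permutations"
begin

text \<open>
  The \<open>n\<close>-tuples over \<open>I\<close> are the extensional functions in \<open>{1..n} \<rightarrow>\<^sub>E I\<close>, so that equality of
  tuples is equality of functions. A map \<open>f : I^n \<rightarrow> \<real>\<close> is a total HOL function, of which only the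
  values on \<open>{1..n} \<rightarrow>\<^sub>E I\<close> are ever used.
\<close>

abbreviation cube :: "nat \<Rightarrow> real set \<Rightarrow> (nat \<Rightarrow> real) set" where
  "cube n I \<equiv> {1..n} \<rightarrow>\<^sub>E I"

definition sorted_cone :: "nat \<Rightarrow> real set \<Rightarrow> (nat \<Rightarrow> nat) \<Rightarrow> (nat \<Rightarrow> real) set" where
  "sorted_cone n I \<sigma> = {x \<in> cube n I. \<forall>i\<in>{1..<n}. x (\<sigma> i) \<le> x (\<sigma> (i + 1))}"

definition A_down :: "(nat \<Rightarrow> nat) \<Rightarrow> nat \<Rightarrow> nat set" where
  "A_down \<sigma> i = \<sigma> ` {1..i}"

definition ind_tuple :: "nat \<Rightarrow> nat set \<Rightarrow> nat \<Rightarrow> real" where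
  "ind_tuple n A = (\<lambda>i\<in>{1..n}. if i \<in> A then 1 else 0)"

definition scale_tuple :: "nat \<Rightarrow> real \<Rightarrow> (nat \<Rightarrow> real) \<Rightarrow> nat \<Rightarrow> real" where
  "scale_tuple n t x = (\<lambda>i\<in>{1..n}. t * x i)"

definition delta :: "nat \<Rightarrow> ((nat \<Rightarrow> real) \<Rightarrow> real) \<Rightarrow> nat set \<Rightarrow> real \<Rightarrow> real" where
  "delta n h A t = h (scale_tuple n t (ind_tuple n A))"

definition additive_on :: "real set \<Rightarrow> (real \<Rightarrow> real) \<Rightarrow> bool" where
  "additive_on K u \<longleftrightarrow> (\<forall>x\<in>K. \<forall>x'\<in>K. x + x' \<in> K \<longrightarrow> u (x + x') = u x + u x')"

definition join_tuple :: "nat \<Rightarrow> (nat \<Rightarrow> real) \<Rightarrow> real \<Rightarrow> nat \<Rightarrow> real" where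
  "join_tuple n x c = (\<lambda>i\<in>{1..n}. max (x i) c)"

definition lower_part :: "nat \<Rightarrow> (nat \<Rightarrow> real) \<Rightarrow> real \<Rightarrow> nat \<Rightarrow> real" where
  "lower_part n x c = (\<lambda>i\<in>{1..n}. x i - join_tuple n x c i)"

definition horizontally_max_additive ::
    "nat \<Rightarrow> real set \<Rightarrow> ((nat \<Rightarrow> real) \<Rightarrow> real) \<Rightarrow> bool" where
  "horizontally_max_additive n I f \<longleftrightarrow>
     (\<forall>x\<in>cube n I. \<forall>c\<in>I. lower_part n x c \<in> cube n I \<longrightarrow>
        f x = f (join_tuple n x c) + f (lower_part n x c))"

definition max_representation ::
    "nat \<Rightarrow> real set \<Rightarrow> ((nat \<Rightarrow> real) \<Rightarrow> real) \<Rightarrow> ((nat \<Rightarrow> real) \<Rightarrow> real) \<Rightarrow> bool" where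
  "max_representation n I f h \<longleftrightarrow>
     additive_on I (delta n h {1..n}) \<and>
     (\<forall>A. A \<subseteq> {1..n} \<longrightarrow> additive_on (I \<inter> {..0}) (delta n h A)) \<and>
     (\<forall>\<sigma>. \<sigma> permutes {1..n} \<longrightarrow>
        (\<forall>x\<in>sorted_cone n I \<sigma>.
           f x = delta n h {1..n} (x (\<sigma> n)) +
                 (\<Sum>i = 1..n - 1. delta n h (A_down \<sigma> i) (x (\<sigma> i) - x (\<sigma> (i + 1))))))"

end

theory Submission
  imports Defs
begin

text \<open>
  Both directions rest on horizontal slicing. For a tuple \<open>x\<close> listed increasingly by \<open>\<sigma>\<close>, raise the
  truncation level through \<open>x (\<sigma> 1) \<le> \<dots> \<le> x (\<sigma> n)\<close>. Passing from \<open>x \<or> x (\<sigma> k)\<close> to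
  \<open>x \<or> x (\<sigma> (k + 1))\<close> cuts off the slice \<open>(x (\<sigma> k) - x (\<sigma> (k + 1))) \<one>\<^sub>A\<close> with
  \<open>A = {\<sigma> 1, \<dots>, \<sigma> k}\<close>. If \<open>f\<close> is horizontally max-additive, each cut contributes the value of
  \<open>f\<close> on its slice, and what is left at the end is the constant tuple of value \<open>x (\<sigma> n)\<close>:
  this is the representation with \<open>h = f\<close> (\<open>telescoping_slices\<close>). The additivity of the
  \<open>\<delta>\<close>-functions comes from truncating the tuples \<open>(t + s) \<one>\<^sub>A\<close> at \<open>t\<close>
  (\<open>max_additive_delta_add\<close>).

  Conversely, both \<open>x \<or> c\<close> and \<open>[x]\<^sup>c\<close> depend on each component of \<open>x\<close> through an increasing
  function, so a permutation that sorts \<open>x\<close> sorts them as well. Their consecutive differences are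
  nonpositive and add up to those of \<open>x\<close>, so the three representations can be compared term by
  term using additivity on the nonpositive part of \<open>I\<close> (\<open>max_representation_imp_max_additive\<close>).

  In both directions the slice heights must themselves belong to \<open>I\<close>, and for this \<open>I\<close> is
  assumed to be nonpositive or the whole line (\<open>nonpos_difference_mem\<close>).
\<close>

lemma delta_eq: "delta n h A t = h (\<lambda>i\<in>{1..n}. if i \<in> A then t else 0)"
proof -
  have "scale_tuple n t (ind_tuple n A) = (\<lambda>i\<in>{1..n}. if i \<in> A then t else 0)"
    by (auto simp: scale_tuple_def ind_tuple_def fun_eq_iff)
  then show ?thesis by (simp add: delta_def)
qed

lemma nonpos_difference_mem:
  fixes I :: "real set"
  assumes "is_interval I" "0 \<in> I" "I \<subseteq> {..0} \<or> I = UNIV" "a \<in> I" "b \<in> I" "a \<le> b"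
  shows "a - b \<in> I \<inter> {..0}"
proof (cases "I = UNIV")
  case True
  then show ?thesis using assms by simp
next
  case False
  then have "b \<le> 0" using assms by auto
  then show ?thesis
    using mem_is_interval_1_I[OF assms(1,4,2), of "a - b"] assms(6) by auto
qed

text \<open>
  Truncating \<open>(t + s) \<one>\<^sub>A\<close> at level \<open>t\<close> cuts it into \<open>t \<one>\<^sub>A\<close> and \<open>s \<one>\<^sub>A\<close>. The components outside
  \<open>A\<close> must not be lifted by the truncation, which is why \<open>t\<close> has to be nonpositive unless there are
  no such components.
\<close>
lemma max_additive_delta_add:
  assumes f: "horizontally_max_additive n I f" and "0 \<in> I"
    and I: "t \<in> I" "s \<in> I" "t + s \<in> I"
    and "s \<le> 0" and t: "t \<le> 0 \<or> A = {1..n}"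
  shows "delta n f A (t + s) = delta n f A t + delta n f A s"
proof -
  let ?ind = "\<lambda>r. \<lambda>i\<in>{1..n}. if i \<in> A then r else (0::real)"
  have join: "join_tuple n (?ind (t + s)) t = ?ind t"
    using t \<open>s \<le> 0\<close> by (auto simp: join_tuple_def fun_eq_iff)
  have lower: "lower_part n (?ind (t + s)) t = ?ind s"
    unfolding lower_part_def join by (auto simp: fun_eq_iff)
  have cube: "?ind (t + s) \<in> cube n I" "?ind s \<in> cube n I"
    using I \<open>0 \<in> I\<close> by auto
  show ?thesis
    unfolding delta_eq
    using f[unfolded horizontally_max_additive_def, rule_format, OF cube(1) \<open>t \<in> I\<close>] cube(2)
    unfolding join lower by blast
qed

text \<open>
  Truncation only gives additivity when the second summand is nonpositive. On the whole line two
  positive summands are handled by moving one of them to the other side.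
\<close>
lemma max_additive_diagonal_additive:
  assumes f: "horizontally_max_additive n I f" and "0 \<in> I" and "I \<subseteq> {..0} \<or> I = UNIV"
  shows "additive_on I (delta n f {1..n})"
  unfolding additive_on_def
proof (intro ballI impI)
  fix t s assume I: "t \<in> I" "s \<in> I" "t + s \<in> I"
  note add = max_additive_delta_add[OF f \<open>0 \<in> I\<close>, where A = "{1..n}"]
  show "delta n f {1..n} (t + s) = delta n f {1..n} t + delta n f {1..n} s"
  proof (cases "s \<le> 0")
    case True
    then show ?thesis using add I by blast
  next
    case False
    then have "I = UNIV" using assms I by auto
    have "delta n f {1..n} t = delta n f {1..n} (t + s) + delta n f {1..n} (- s)"
      using add[of "t + s" "- s"] False \<open>I = UNIV\<close> by simp
    moreover have "delta n f {1..n} 0 = delta n f {1..n} s + delta n f {1..n} (- s)"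
      using add[of s "- s"] False \<open>I = UNIV\<close> by simp
    moreover have "delta n f {1..n} 0 = 0"
      using add[of 0 0] \<open>0 \<in> I\<close> by simp
    ultimately show ?thesis by simp
  qed
qed

lemma sorted_cone_le:
  assumes "x \<in> sorted_cone n I \<sigma>" "1 \<le> i" "i \<le> j" "j \<le> n"
  shows "x (\<sigma> i) \<le> x (\<sigma> j)"
  using assms(3,4)
proof (induction j rule: dec_induct)
  case base
  show ?case by simp
next
  case (step j)
  moreover have "x (\<sigma> j) \<le> x (\<sigma> (j + 1))"
    using assms(1,2) step by (auto simp: sorted_cone_def)
  ultimately show ?case by simp
qed

text \<open>
  The slice between the levels \<open>x (\<sigma> k)\<close> and \<open>x (\<sigma> (k + 1))\<close> is supported on the \<open>k\<close> smallest
  components and constant there, since the truncation at \<open>x (\<sigma> k)\<close> has made these components equal.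
\<close>
lemma max_additive_cut_slice:
  assumes f: "horizontally_max_additive n I f"
    and I: "is_interval I" "0 \<in> I" "I \<subseteq> {..0} \<or> I = UNIV"
    and \<sigma>: "\<sigma> permutes {1..n}" and x: "x \<in> sorted_cone n I \<sigma>" and k: "1 \<le> k" "k < n"
  shows "f (join_tuple n x (x (\<sigma> k))) =
    f (join_tuple n x (x (\<sigma> (k + 1)))) + delta n f (A_down \<sigma> k) (x (\<sigma> k) - x (\<sigma> (k + 1)))"
proof -
  let ?y = "join_tuple n x (x (\<sigma> k))" and ?c = "x (\<sigma> (k + 1))"
  let ?s = "\<lambda>i\<in>{1..n}. if i \<in> A_down \<sigma> k then x (\<sigma> k) - ?c else 0"
  have cube: "x \<in> cube n I" using x by (simp add: sorted_cone_def)
  have mem: "x (\<sigma> j) \<in> I" if "j \<in> {1..n}" for j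
    using cube permutes_in_image[OF \<sigma>] that by blast
  have k_le: "x (\<sigma> k) \<le> ?c" using sorted_cone_le[OF x, of k "k + 1"] k by simp
  have join: "join_tuple n ?y ?c = join_tuple n x ?c"
    using k_le by (auto simp: join_tuple_def fun_eq_iff)
  have lower: "lower_part n ?y ?c = ?s"
  proof
    fix i
    show "lower_part n ?y ?c i = ?s i"
    proof (cases "i \<in> {1..n}")
      case True
      then obtain j where j: "j \<in> {1..n}" "i = \<sigma> j"
        using permutes_image[OF \<sigma>] by blast
      have down: "i \<in> A_down \<sigma> k \<longleftrightarrow> j \<le> k"
        using j k permutes_inj[OF \<sigma>] by (auto simp: A_down_def inj_eq)
      show ?thesis
      proof (cases "j \<le> k")
        case True
        have "x i \<le> x (\<sigma> k)" using sorted_cone_le[OF x, of j k] j k True by simp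
        then show ?thesis
          using k_le True down \<open>i \<in> {1..n}\<close> by (simp add: lower_part_def join_tuple_def)
      next
        case False
        have "?c \<le> x i" using sorted_cone_le[OF x, of "k + 1" j] j k False by simp
        then show ?thesis
          using k_le False down \<open>i \<in> {1..n}\<close> by (simp add: lower_part_def join_tuple_def)
      qed
    qed (auto simp: lower_part_def)
  qed
  have y_cube: "?y \<in> cube n I"
    using cube mem[of k] k by (auto simp: join_tuple_def max_def)
  have c_mem: "?c \<in> I" using mem[of "k + 1"] k by simp
  have "x (\<sigma> k) - ?c \<in> I"
    using nonpos_difference_mem[OF I mem[of k] c_mem k_le] k by simp
  then have "?s \<in> cube n I" using I by auto
  then show ?thesis
    using f[unfolded horizontally_max_additive_def, rule_format, OF y_cube c_mem]
    unfolding join lower delta_eq by blast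
qed

text \<open>
  Cutting off one slice after another; the downward induction starts from the constant tuple that
  remains at the level \<open>x (\<sigma> n)\<close>.
\<close>
lemma telescoping_slices:
  assumes f: "horizontally_max_additive n I f"
    and I: "is_interval I" "0 \<in> I" "I \<subseteq> {..0} \<or> I = UNIV"
    and \<sigma>: "\<sigma> permutes {1..n}" and x: "x \<in> sorted_cone n I \<sigma>" and k: "1 \<le> k" "k \<le> n"
  shows "f (join_tuple n x (x (\<sigma> k))) = delta n f {1..n} (x (\<sigma> n)) +
    (\<Sum>i = k..<n. delta n f (A_down \<sigma> i) (x (\<sigma> i) - x (\<sigma> (i + 1))))"
  using k(2,1)
proof (induction k rule: inc_induct)
  case base
  have "x i \<le> x (\<sigma> n)" if i: "i \<in> {1..n}" for i
  proof -
    obtain j where "j \<in> {1..n}" "i = \<sigma> j" using permutes_image[OF \<sigma>] i by blast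
    then show ?thesis using sorted_cone_le[OF x, of j n] by simp
  qed
  then have "join_tuple n x (x (\<sigma> n)) = (\<lambda>i\<in>{1..n}. if i \<in> {1..n} then x (\<sigma> n) else 0)"
    by (auto simp: join_tuple_def fun_eq_iff)
  then show ?case by (simp only: delta_eq atLeastLessThan_empty order_refl sum.empty add_0_right)
next
  case (step k)
  have "f (join_tuple n x (x (\<sigma> k))) = f (join_tuple n x (x (\<sigma> (Suc k))))
      + delta n f (A_down \<sigma> k) (x (\<sigma> k) - x (\<sigma> (k + 1)))"
    using max_additive_cut_slice[OF f I \<sigma> x, of k] step by simp
  then show ?case
    using step by (simp add: sum.atLeast_Suc_lessThan)
qed

lemma max_additive_imp_max_representation:
  assumes "n \<ge> 1" and f: "horizontally_max_additive n I f"
    and I: "is_interval I" "0 \<in> I" "I \<subseteq> {..0} \<or> I = UNIV"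
  shows "max_representation n I f f"
  unfolding max_representation_def
proof (intro conjI allI impI ballI)
  show "additive_on I (delta n f {1..n})"
    by (rule max_additive_diagonal_additive[OF f I(2,3)])
next
  fix A
  show "additive_on (I \<inter> {..0}) (delta n f A)"
    using max_additive_delta_add[OF f I(2)] by (auto simp: additive_on_def)
next
  fix \<sigma> x assume \<sigma>: "\<sigma> permutes {1..n}" and x: "x \<in> sorted_cone n I \<sigma>"
  have "x (\<sigma> 1) \<le> x i" if i: "i \<in> {1..n}" for i
  proof -
    obtain j where "j \<in> {1..n}" "i = \<sigma> j" using permutes_image[OF \<sigma>] i by blast
    then show ?thesis using sorted_cone_le[OF x, of 1 j] by simp
  qed
  then have "join_tuple n x (x (\<sigma> 1)) = restrict x {1..n}"
    by (auto simp: join_tuple_def fun_eq_iff)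
  also have "\<dots> = x"
    using x by (auto simp: sorted_cone_def intro: PiE_restrict)
  finally have "join_tuple n x (x (\<sigma> 1)) = x" .
  moreover have "{1..<n} = {1..n - 1}" by auto
  ultimately show "f x = delta n f {1..n} (x (\<sigma> n)) +
      (\<Sum>i = 1..n - 1. delta n f (A_down \<sigma> i) (x (\<sigma> i) - x (\<sigma> (i + 1))))"
    using telescoping_slices[OF f I \<sigma> x, of 1] \<open>n \<ge> 1\<close> by simp
qed

lemma sorting_permutation_exists:
  assumes "x \<in> cube n I"
  obtains \<sigma> where "\<sigma> permutes {1..n}" "x \<in> sorted_cone n I \<sigma>"
proof -
  define xs where "xs = sort_key x [1..<n + 1]"
  have xs: "length xs = n" "distinct xs" "set xs = {1..n}" "sorted (map x xs)"
    by (auto simp: xs_def)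
  define \<sigma> where "\<sigma> i = (if i \<in> {1..n} then xs ! (i - 1) else i)" for i
  have "bij_betw (\<lambda>i. i - 1) {1..n} {..<n}"
    by (rule bij_betw_byWitness[where f' = Suc]) auto
  moreover have "bij_betw ((!) xs) {..<n} {1..n}"
    using xs by (intro bij_betw_nth) auto
  ultimately have "bij_betw ((!) xs \<circ> (\<lambda>i. i - 1)) {1..n} {1..n}"
    by (rule bij_betw_trans)
  then have "bij_betw \<sigma> {1..n} {1..n}"
    by (rule bij_betw_cong[THEN iffD1, rotated]) (simp add: \<sigma>_def)
  then have "\<sigma> permutes {1..n}"
    by (rule bij_imp_permutes) (auto simp: \<sigma>_def)
  moreover have "x (\<sigma> i) \<le> x (\<sigma> (i + 1))" if "i \<in> {1..<n}" for i
    using sorted_nth_mono[OF xs(4), of "i - 1" i] that xs(1) by (simp add: \<sigma>_def)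
  ultimately show thesis
    using that assms by (simp add: sorted_cone_def)
qed

text \<open>
  In each component \<open>x \<or> c\<close> is \<open>t \<mapsto> max t c\<close> and \<open>[x]\<^sup>c\<close> is \<open>t \<mapsto> t - max t c = min (t - c) 0\<close>. Both are
  increasing, so one permutation sorts all three tuples, and \<open>max t c + (t - max t c) = t\<close> matches
  their representations.
\<close>
lemma max_representation_imp_max_additive:
  assumes "n \<ge> 1" and rep: "max_representation n I f h"
    and I: "is_interval I" "0 \<in> I" "I \<subseteq> {..0} \<or> I = UNIV"
  shows "horizontally_max_additive n I f"
  unfolding horizontally_max_additive_def
proof (intro ballI impI)
  fix x c assume x: "x \<in> cube n I" and c: "c \<in> I" and l: "lower_part n x c \<in> cube n I"
  let ?j = "join_tuple n x c" and ?l = "lower_part n x c"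
  obtain \<sigma> where \<sigma>: "\<sigma> permutes {1..n}" and xs: "x \<in> sorted_cone n I \<sigma>"
    using sorting_permutation_exists[OF x] .
  have \<sigma>_mem: "\<sigma> i \<in> {1..n}" if "i \<in> {1..n}" for i
    using permutes_in_image[OF \<sigma>] that by blast
  have j: "?j \<in> cube n I"
    using x c by (auto simp: join_tuple_def max_def)
  have j_eq: "?j (\<sigma> i) = max (x (\<sigma> i)) c" if "i \<in> {1..n}" for i
    using \<sigma>_mem[OF that] by (simp add: join_tuple_def)
  have l_eq: "?l (\<sigma> i) = x (\<sigma> i) - ?j (\<sigma> i)" if "i \<in> {1..n}" for i
    using \<sigma>_mem[OF that] by (simp add: lower_part_def)
  have mono: "?j (\<sigma> i) \<le> ?j (\<sigma> (i + 1)) \<and> ?l (\<sigma> i) \<le> ?l (\<sigma> (i + 1))" if "i \<in> {1..<n}" for i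
  proof -
    have "x (\<sigma> i) \<le> x (\<sigma> (i + 1))" using xs that by (simp add: sorted_cone_def)
    then show ?thesis
      using j_eq[of i] j_eq[of "i + 1"] l_eq[of i] l_eq[of "i + 1"] that by auto
  qed
  have js: "?j \<in> sorted_cone n I \<sigma>" and ls: "?l \<in> sorted_cone n I \<sigma>"
    using j l mono by (auto simp: sorted_cone_def)
  have cube_mem: "y (\<sigma> i) \<in> I" if "y \<in> cube n I" "i \<in> {1..n}" for y i
    using that(1) \<sigma>_mem[OF that(2)] by blast
  have split: "x (\<sigma> i) = ?j (\<sigma> i) + ?l (\<sigma> i)" if "i \<in> {1..n}" for i
    using l_eq[OF that] by simp
  have "n \<in> {1..n}" using \<open>n \<ge> 1\<close> by simp
  then have top: "delta n h {1..n} (x (\<sigma> n)) =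
      delta n h {1..n} (?j (\<sigma> n)) + delta n h {1..n} (?l (\<sigma> n))"
    using rep cube_mem[OF x, of n] cube_mem[OF j, of n] cube_mem[OF l, of n] split[of n]
    unfolding max_representation_def additive_on_def by metis
  have slices: "delta n h (A_down \<sigma> i) (x (\<sigma> i) - x (\<sigma> (i + 1))) =
      delta n h (A_down \<sigma> i) (?j (\<sigma> i) - ?j (\<sigma> (i + 1))) +
      delta n h (A_down \<sigma> i) (?l (\<sigma> i) - ?l (\<sigma> (i + 1)))" if i: "i \<in> {1..n - 1}" for i
  proof -
    have i': "i \<in> {1..n}" "i + 1 \<in> {1..n}" "i \<in> {1..<n}" using i by auto
    have "A_down \<sigma> i \<subseteq> {1..n}" using \<sigma>_mem i' by (fastforce simp: A_down_def)
    then have add: "additive_on (I \<inter> {..0}) (delta n h (A_down \<sigma> i))"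
      using rep by (simp add: max_representation_def)
    have diff: "y (\<sigma> i) - y (\<sigma> (i + 1)) \<in> I \<inter> {..0}" if "y \<in> sorted_cone n I \<sigma>" for y
      using nonpos_difference_mem[OF I] cube_mem[of y] that i' by (auto simp: sorted_cone_def)
    have "x (\<sigma> i) - x (\<sigma> (i + 1)) = (?j (\<sigma> i) - ?j (\<sigma> (i + 1))) + (?l (\<sigma> i) - ?l (\<sigma> (i + 1)))"
      using split[OF i'(1)] split[OF i'(2)] by simp
    then show ?thesis
      using add diff[OF xs] diff[OF js] diff[OF ls] unfolding additive_on_def by metis
  qed
  have rep_f: "f y = delta n h {1..n} (y (\<sigma> n)) +
      (\<Sum>i = 1..n - 1. delta n h (A_down \<sigma> i) (y (\<sigma> i) - y (\<sigma> (i + 1))))"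
    if "y \<in> sorted_cone n I \<sigma>" for y
    using rep \<sigma> that unfolding max_representation_def by blast
  have "(\<Sum>i = 1..n - 1. delta n h (A_down \<sigma> i) (x (\<sigma> i) - x (\<sigma> (i + 1)))) =
      (\<Sum>i = 1..n - 1. delta n h (A_down \<sigma> i) (?j (\<sigma> i) - ?j (\<sigma> (i + 1)))) +
      (\<Sum>i = 1..n - 1. delta n h (A_down \<sigma> i) (?l (\<sigma> i) - ?l (\<sigma> (i + 1))))"
    unfolding sum.distrib[symmetric] by (rule sum.cong[OF refl slices])
  then show "f x = f ?j + f ?l"
    unfolding rep_f[OF xs] rep_f[OF js] rep_f[OF ls] top by linarith
qed

theorem theorem4:
  fixes n :: nat and I :: "real set" and f :: "(nat \<Rightarrow> real) \<Rightarrow> real"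
  assumes "n \<ge> 1"
    and "is_interval I" and "emeasure lborel I > 0" and "0 \<in> I"
    and "I \<subseteq> {..0} \<or> I = UNIV"
  shows "(horizontally_max_additive n I f \<longleftrightarrow> (\<exists>h. max_representation n I f h)) \<and>
         (horizontally_max_additive n I f \<longrightarrow> max_representation n I f f)"
  using max_additive_imp_max_representation[OF assms(1) _ assms(2,4,5)]
    max_representation_imp_max_additive[OF assms(1) _ assms(2,4,5)] by blast

end
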